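(* Let $S$ be a left cancellative generalized $1$-monoid with respect to a surjective size map $\lambda \colon S \rightarrow \mathbb{N}$. Let $X$ be a transversal of the $\mathscr{R}$-classes of the atoms of $S$. Denote by $X^{\ast}$ the submonoid of $S$ generated by the elements of $X$, and denote by $G$ the group of units of $S$. Then $X^{\ast}$ is a free monoid, and every element of $S$ can be written uniquely as a product of an element of $X^{\ast}$ followed by an element of $G$.
   Context: Here $\mathbb{N}=\{0,1,2,\ldots\}$ under addition. A monoid homomorphism $\lambda \colon S \rightarrow \mathbb{N}$ is a size map if $\lambda^{-1}(0)$ is precisely the group of units of $S$. The monoid $S$ is a generalized $1$-monoid with respect to the size map $\lambda$ if $\lambda$ satisfies the weak factorization property (WFP): whenever $x \in S$ and $m,n \in \mathbb{N}$ satisfy $\lambda(x) = m+n$, there exist elements $x_1, x_2 \in S$ such that $x = x_1x_2$, $\lambda(x_1) = m$ and $\lambda(x_2)=n$, and, furthermore, if $x_1', x_2' \in S$ are any elements such that $x = x_1'x_2'$, $\lambda(x_1')=m$ and $\lambda(x_2')=n$, then $x_1' = x_1g$ and $x_2' = g^{-1}x_2$ for some invertible element $g \in S$. Left cancellative means that $xy = xv$ implies $y = v$. An atom in a monoid is a non-invertible element $a$ such that if $a = bc$ then at least one of $b$ or $c$ is invertible. $\mathscr{R}$ is Green's relation: $a \,\mathscr{R}\, b$ if and only if $aS = bS$. A transversal of the $\mathscr{R}$-classes of the atoms is a set of atoms containing exactly one element of each $\mathscr{R}$-class that contains an atom (if $a$ is an atom, its $\mathscr{R}$-class consists of atoms).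 *)

theory Defs
  imports "HOL-Algebra.Coset" "HOL.Hull"
begin

definition left_cancellative :: "('a, 'b) monoid_scheme \<Rightarrow> bool" where
  "left_cancellative S \<longleftrightarrow>
     (\<forall>x\<in>carrier S. \<forall>y\<in>carrier S. \<forall>v\<in>carrier S. x \<otimes>\<^bsub>S\<^esub> y = x \<otimes>\<^bsub>S\<^esub> v \<longrightarrow> y = v)"

definition size_map :: "('a, 'b) monoid_scheme \<Rightarrow> ('a \<Rightarrow> nat) \<Rightarrow> bool" where
  "size_map S l \<longleftrightarrow>
     l \<one>\<^bsub>S\<^esub> = 0 \<and>
     (\<forall>x\<in>carrier S. \<forall>y\<in>carrier S. l (x \<otimes>\<^bsub>S\<^esub> y) = l x + l y) \<and>
     {x \<in> carrier S. l x = 0} = Units S"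

definition weak_factorization_property :: "('a, 'b) monoid_scheme \<Rightarrow> ('a \<Rightarrow> nat) \<Rightarrow> bool" where
  "weak_factorization_property S l \<longleftrightarrow>
     (\<forall>x\<in>carrier S. \<forall>m n. l x = m + n \<longrightarrow>
        (\<exists>x1\<in>carrier S. \<exists>x2\<in>carrier S.
           x = x1 \<otimes>\<^bsub>S\<^esub> x2 \<and> l x1 = m \<and> l x2 = n \<and>
           (\<forall>x1'\<in>carrier S. \<forall>x2'\<in>carrier S.
              x = x1' \<otimes>\<^bsub>S\<^esub> x2' \<and> l x1' = m \<and> l x2' = n \<longrightarrow>
              (\<exists>g\<in>Units S. x1' = x1 \<otimes>\<^bsub>S\<^esub> g \<and> x2' = inv\<^bsub>S\<^esub> g \<otimes>\<^bsub>S\<^esub> x2))))"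

definition generalized_1_monoid :: "('a, 'b) monoid_scheme \<Rightarrow> ('a \<Rightarrow> nat) \<Rightarrow> bool" where
  "generalized_1_monoid S l \<longleftrightarrow> monoid S \<and> size_map S l \<and> weak_factorization_property S l"

text \<open>The library's notion of irreducible element is phrased through (left) proper divisibility and
  is intended for commutative monoids, so atoms are defined directly.\<close>

definition atoms :: "('a, 'b) monoid_scheme \<Rightarrow> 'a set" where
  "atoms S = {a \<in> carrier S. a \<notin> Units S \<and>
     (\<forall>b\<in>carrier S. \<forall>c\<in>carrier S. a = b \<otimes>\<^bsub>S\<^esub> c \<longrightarrow> b \<in> Units S \<or> c \<in> Units S)}"

definition green_R :: "('a, 'b) monoid_scheme \<Rightarrow> 'a \<Rightarrow> 'a \<Rightarrow> bool" where
  "green_R S a b \<longleftrightarrow> a <#\<^bsub>S\<^esub> carrier S = b <#\<^bsub>S\<^esub> carrier S"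

definition atom_transversal :: "('a, 'b) monoid_scheme \<Rightarrow> 'a set \<Rightarrow> bool" where
  "atom_transversal S X \<longleftrightarrow> X \<subseteq> atoms S \<and> (\<forall>a\<in>atoms S. \<exists>!x. x \<in> X \<and> green_R S a x)"

definition generated_submonoid :: "('a, 'b) monoid_scheme \<Rightarrow> 'a set \<Rightarrow> 'a set" where
  "generated_submonoid S X = (\<lambda>H. submonoid H S) hull X"

definition free_monoid_on :: "'c set \<Rightarrow> 'c list monoid" where
  "free_monoid_on A = \<lparr>carrier = lists A, mult = (@), one = []\<rparr>"

text \<open>Restricting the alphabet to the element type of \<open>M\<close> loses no generality: an isomorphism
  from a free monoid onto \<open>M\<close> is injective on one-letter words and so embeds its alphabet
  into \<open>M\<close>. A multiplicative bijection between monoids automatically preserves the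
  identity, so the library's isomorphism relation is the one for monoids.\<close>

definition is_free_monoid :: "('a, 'b) monoid_scheme \<Rightarrow> bool" where
  "is_free_monoid M \<longleftrightarrow> monoid M \<and> (\<exists>A :: 'a set. free_monoid_on A \<cong> M)"

end

theory Submission
  imports Defs
begin

text \<open>The atoms are exactly the elements of size one, so splitting off one unit of size at a time
  and moving the invertible factors to the right writes every element as a word in \<open>X\<close> times a
  unit. For uniqueness, the weak factorization property makes the first letters of two such
  expressions \<open>\<R>\<close>-related, hence equal, and left cancellation removes them.\<close>

section \<open>Words over a set of monoid elements, and Green's relation\<close>

context monoid
begin

text \<open>The evaluation of words; restricted to \<open>lists X\<close> it becomes the isomorphism
  from the free monoid.\<close>

definition word_prod :: "'a list \<Rightarrow> 'a" where
  "word_prod w = foldr (\<otimes>) w \<one>"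

lemma word_prod_Nil [simp]: "word_prod [] = \<one>"
  and word_prod_Cons [simp]: "word_prod (x # w) = x \<otimes> word_prod w"
  by (simp_all add: word_prod_def)

lemma word_prod_closed [simp]: "set w \<subseteq> carrier G \<Longrightarrow> word_prod w \<in> carrier G"
  by (induction w) auto

lemma word_prod_append:
  "\<lbrakk>set v \<subseteq> carrier G; set w \<subseteq> carrier G\<rbrakk> \<Longrightarrow> word_prod (v @ w) = word_prod v \<otimes> word_prod w"
  by (induction v) (auto simp: m_assoc)

lemma submonoid_word_prod_image:
  assumes "X \<subseteq> carrier G"
  shows "submonoid (word_prod ` lists X) G"
proof
  have sub: "set w \<subseteq> carrier G" if "w \<in> lists X" for w
    using that assms by auto
  then show "word_prod ` lists X \<subseteq> carrier G"
    by (blast intro: word_prod_closed)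
  show "\<one> \<in> word_prod ` lists X"
    by (rule image_eqI[of _ _ "[]"]) auto
  fix x y
  assume "x \<in> word_prod ` lists X" "y \<in> word_prod ` lists X"
  then obtain v w where "v \<in> lists X" "w \<in> lists X" "x = word_prod v" "y = word_prod w"
    by blast
  then show "x \<otimes> y \<in> word_prod ` lists X"
    using word_prod_append sub by (intro image_eqI[of _ _ "v @ w"]) auto
qed

text \<open>The values of words form a submonoid containing \<open>X\<close>, and closure under
  products puts them into every other such submonoid, so they are the hull.\<close>

lemma generated_submonoid_eq:
  assumes "X \<subseteq> carrier G"
  shows "generated_submonoid G X = word_prod ` lists X"
  unfolding generated_submonoid_def
proof (rule hull_unique)
  show "X \<subseteq> word_prod ` lists X"
  proof
    fix x assume "x \<in> X"
    then show "x \<in> word_prod ` lists X"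
      using assms by (intro image_eqI[of _ _ "[x]"]) auto
  qed
  show "submonoid (word_prod ` lists X) G"
    using assms by (rule submonoid_word_prod_image)
  fix H assume "X \<subseteq> H" and H: "submonoid H G"
  have "word_prod w \<in> H" if "w \<in> lists X" for w
    using that
    by (induction w) (use \<open>X \<subseteq> H\<close> H in \<open>auto intro: submonoid.one_closed submonoid.m_closed\<close>)
  then show "word_prod ` lists X \<subseteq> H"
    by blast
qed

text \<open>The nontrivial inclusion comes from inserting \<open>g \<otimes> inv g\<close> between
  \<open>x\<close> and \<open>y\<close>.\<close>

lemma green_R_mult_unit:
  assumes "x \<in> carrier G" "g \<in> Units G"
  shows "green_R G (x \<otimes> g) x"
  unfolding green_R_def
proof
  have g: "g \<in> carrier G"
    using assms by (simp add: Units_closed)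
  show "(x \<otimes> g) <# carrier G \<subseteq> x <# carrier G"
    using assms g by (auto simp: l_coset_def m_assoc)
  have "x \<otimes> y = x \<otimes> g \<otimes> (inv g \<otimes> y)" if "y \<in> carrier G" for y
  proof -
    have "x \<otimes> g \<otimes> (inv g \<otimes> y) = x \<otimes> (g \<otimes> inv g \<otimes> y)"
      using assms g that by (simp only: m_assoc m_closed Units_inv_closed)
    then show ?thesis
      using assms that by simp
  qed
  moreover have "inv g \<otimes> y \<in> carrier G" if "y \<in> carrier G" for y
    using assms that by simp
  ultimately show "x <# carrier G \<subseteq> (x \<otimes> g) <# carrier G"
    unfolding l_coset_def by (auto simp only: UN_iff singleton_iff intro: bexI)
qed

lemma green_R_dvd:
  assumes "green_R G x y" "x \<in> carrier G"
  obtains c where "c \<in> carrier G" "x = y \<otimes> c"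
proof -
  have "x \<in> x <# carrier G"
    using assms(2) unfolding l_coset_def by (auto intro!: bexI[of _ \<one>])
  then show thesis
    using assms(1) that unfolding green_R_def l_coset_def by auto
qed

end

section \<open>Sizes, atoms and normal forms\<close>

locale generalized_1_monoid_transversal = monoid S for S (structure) +
  fixes l :: "'a \<Rightarrow> nat" and X :: "'a set"
  assumes cancel: "left_cancellative S"
    and size: "size_map S l"
    and wfp: "weak_factorization_property S l"
    and transversal: "atom_transversal S X"
begin

lemma size_mult: "\<lbrakk>x \<in> carrier S; y \<in> carrier S\<rbrakk> \<Longrightarrow> l (x \<otimes> y) = l x + l y"
  using size by (simp add: size_map_def)

lemma size_eq_0_iff: "x \<in> carrier S \<Longrightarrow> l x = 0 \<longleftrightarrow> x \<in> Units S"
  using size by (auto simp: size_map_def)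

lemma factorization:
  assumes "x \<in> carrier S" "l x = m + n"
  obtains y z where "y \<in> carrier S" "z \<in> carrier S" "x = y \<otimes> z" "l y = m" "l z = n"
  using wfp assms unfolding weak_factorization_property_def by meson

text \<open>The two factorizations of one element have the same pair of sizes, so the weak
  factorization property makes both left factors unit multiples of a common element.\<close>

lemma green_R_if_mult_eq:
  assumes "x \<in> carrier S" "y \<in> carrier S" "s \<in> carrier S" "t \<in> carrier S"
    and eq: "x \<otimes> s = y \<otimes> t" and "l x = l y"
  shows "green_R S x y"
proof -
  have "l (x \<otimes> s) = l x + l s"
    using assms(1,3) by (rule size_mult)
  moreover have "l t = l s"
    using size_mult[of x s] size_mult[of y t] assms(1-4,6) unfolding eq by simp
  moreover have "x \<otimes> s \<in> carrier S"
    using assms(1,3) by simp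
  \<comment> \<open>The property compares factorizations only with the one it supplies. Its left
    factor is \<open>z\<close>, and \<open>x\<close> and \<open>y\<close> are each compared with
    it.\<close>
  ultimately obtain z where z: "z \<in> carrier S"
    "\<And>x' s'. \<lbrakk>x' \<in> carrier S; s' \<in> carrier S; x \<otimes> s = x' \<otimes> s'; l x' = l x; l s' = l s\<rbrakk>
      \<Longrightarrow> \<exists>g\<in>Units S. x' = z \<otimes> g"
    using wfp[unfolded weak_factorization_property_def, rule_format, of "x \<otimes> s" "l x" "l s"]
    by fast
  obtain g where "g \<in> Units S" "x = z \<otimes> g"
    using z(2)[of x s] assms(1,3) by blast
  moreover obtain h where "h \<in> Units S" "y = z \<otimes> h"
    using z(2)[OF assms(2,4) eq] \<open>l x = l y\<close> \<open>l t = l s\<close> by auto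
  ultimately show ?thesis
    using green_R_mult_unit z(1) unfolding green_R_def by simp
qed

text \<open>An atom splits into a factor of size one and a rest; the first factor is no unit, so the
  rest is one and has size 0. Conversely, if two sizes add up to one, one of them is 0 and belongs
  to a unit.\<close>

lemma atom_iff: "a \<in> atoms S \<longleftrightarrow> a \<in> carrier S \<and> l a = 1"
proof
  assume a: "a \<in> atoms S"
  then have "a \<in> carrier S" "l a \<noteq> 0"
    by (auto simp: atoms_def size_eq_0_iff)
  then obtain b c where bc: "b \<in> carrier S" "c \<in> carrier S" "a = b \<otimes> c" "l b = 1" "l c = l a - 1"
    using factorization[of a 1 "l a - 1"] by auto
  then have "l c = 0"
    using a size_eq_0_iff unfolding atoms_def by fastforce
  then show "a \<in> carrier S \<and> l a = 1"
    using \<open>a \<in> carrier S\<close> \<open>l a \<noteq> 0\<close> bc by auto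
next
  assume "a \<in> carrier S \<and> l a = 1"
  then show "a \<in> atoms S"
    unfolding atoms_def by (auto simp: size_mult add_is_1 size_eq_0_iff simp flip: One_nat_def)
      (simp_all flip: size_eq_0_iff)
qed

lemma X_closed: "x \<in> X \<Longrightarrow> x \<in> carrier S"
  and size_X: "x \<in> X \<Longrightarrow> l x = 1"
  using transversal atom_iff by (auto simp: atom_transversal_def)

lemma lists_X_closed: "w \<in> lists X \<Longrightarrow> set w \<subseteq> carrier S"
  using X_closed by auto

lemma word_prod_X_closed: "w \<in> lists X \<Longrightarrow> word_prod w \<in> carrier S"
  using lists_X_closed by (rule word_prod_closed)

text \<open>\<open>x\<close> is itself an atom, and both \<open>x\<close> and \<open>y\<close>
  represent its class.\<close>

lemma transversal_unique:
  assumes "x \<in> X" "y \<in> X" "green_R S x y"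
  shows "x = y"
  using assms transversal unfolding atom_transversal_def green_R_def by blast

text \<open>The representative \<open>x\<close> divides \<open>a\<close> on the left, and since both
  have size one, the cofactor has size 0.\<close>

lemma atom_eq_mult_unit:
  assumes "a \<in> atoms S"
  obtains x g where "x \<in> X" "g \<in> Units S" "a = x \<otimes> g"
proof -
  obtain x where x: "x \<in> X" "green_R S a x"
    using transversal assms unfolding atom_transversal_def by blast
  moreover from x(2) obtain g where g: "g \<in> carrier S" "a = x \<otimes> g"
    using assms atom_iff by (auto elim: green_R_dvd)
  moreover have "l g = 0"
    using g x assms atom_iff size_mult[of x g] size_X X_closed by simp
  ultimately show thesis
    using that size_eq_0_iff by blast
qed

lemma word_unit_exists:
  assumes "s \<in> carrier S"
  shows "\<exists>w\<in>lists X. \<exists>g\<in>Units S. s = word_prod w \<otimes> g"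
  using assms
proof (induction "l s" arbitrary: s)
  case 0
  then show ?case
    using size_eq_0_iff by (intro bexI[of _ "[]"] bexI[of _ s]) auto
next
  case (Suc n)
  then obtain a t where at: "a \<in> carrier S" "t \<in> carrier S" "s = a \<otimes> t" "l a = 1" "l t = n"
    using factorization[of s 1 n] by auto
  then obtain x g where xg: "x \<in> X" "g \<in> Units S" "a = x \<otimes> g"
    using atom_iff atom_eq_mult_unit by blast
  \<comment> \<open>The unit \<open>g\<close> left over from the atom is absorbed into
    \<open>t\<close>. This keeps the size, so the induction hypothesis applies to
    \<open>g \<otimes> t\<close>.\<close>
  have "l (g \<otimes> t) = n"
    using at xg size_mult size_eq_0_iff[of g] by (simp add: Units_closed)
  then obtain w h where w: "w \<in> lists X" "h \<in> Units S" "g \<otimes> t = word_prod w \<otimes> h"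
    using Suc.hyps(1)[of "g \<otimes> t"] at xg by auto
  have "s = word_prod (x # w) \<otimes> h"
    using at xg w X_closed[of x] word_prod_X_closed[of w] by (simp add: m_assoc Units_closed)
  then show ?case
    using w xg by (intro bexI[of _ "x # w"] bexI[of _ h]) auto
qed

text \<open>Length is thus determined by the value of a word, which allows two words to be compared
  letter by letter.\<close>

lemma size_word_prod: "w \<in> lists X \<Longrightarrow> l (word_prod w) = length w"
proof (induction w)
  case Nil
  then show ?case
    by (simp add: size_eq_0_iff)
next
  case (Cons x w)
  then show ?case
    using lists_X_closed X_closed size_X by (auto simp: size_mult)
qed

lemma word_unit_unique:
  assumes "v \<in> lists X" "w \<in> lists X" "g \<in> Units S" "h \<in> Units S"
    and "word_prod v \<otimes> g = word_prod w \<otimes> h"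
  shows "v = w \<and> g = h"
proof -
  \<comment> \<open>Units have size 0, so both lengths equal the size of the common element.\<close>
  have "length v = length w"
    using assms lists_X_closed size_word_prod size_mult size_eq_0_iff
    by (metis Units_closed add.right_neutral word_prod_closed)
  then show ?thesis
    using assms
  proof (induction v w rule: list_induct2)
    case Nil
    then show ?case
      by (simp add: Units_closed)
  next
    case (Cons x v y w)
    then have mem: "x \<in> X" "y \<in> X" "v \<in> lists X" "w \<in> lists X"
      by auto
    define s t where "s = word_prod v \<otimes> g" and "t = word_prod w \<otimes> h"
    have st: "s \<in> carrier S" "t \<in> carrier S" and eq: "x \<otimes> s = y \<otimes> t"
      using Cons.prems mem word_prod_X_closed[of v] word_prod_X_closed[of w]
        X_closed[of x] X_closed[of y]
      by (simp_all add: s_def t_def m_assoc Units_closed)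
    \<comment> \<open>Both first letters have size one, so they are left factors of equal size of
      the same element.\<close>
    have "x = y"
      using mem st eq green_R_if_mult_eq X_closed size_X by (intro transversal_unique) auto
    then have "s = t"
      using eq st X_closed mem cancel unfolding left_cancellative_def by blast
    then show ?case
      using Cons mem \<open>x = y\<close> by (auto simp: s_def t_def)
  qed
qed

lemma generated_submonoid_X: "generated_submonoid S X = word_prod ` lists X"
  using X_closed by (intro generated_submonoid_eq) auto

lemma is_free_monoid_generated: "is_free_monoid (S\<lparr>carrier := generated_submonoid S X\<rparr>)"
proof -
  let ?M = "S\<lparr>carrier := generated_submonoid S X\<rparr>"
  have "submonoid (generated_submonoid S X) S"
    using submonoid_word_prod_image X_closed unfolding generated_submonoid_X by blast
  then have "monoid ?M"
    by (rule submonoid.submonoid_is_monoid) (rule monoid_axioms)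
  \<comment> \<open>Uniqueness of normal forms with both units equal to
    \<open>\<one>\<close>.\<close>
  moreover have "inj_on word_prod (lists X)"
    using word_unit_unique[of _ _ \<one> \<one>] by (intro inj_onI) simp
  then have "word_prod \<in> iso (free_monoid_on X) ?M"
    using word_prod_append lists_X_closed
    by (auto simp: iso_def hom_def free_monoid_on_def bij_betw_def generated_submonoid_X)
  ultimately show ?thesis
    unfolding is_free_monoid_def is_iso_def by blast
qed

lemma generated_unit_unique_factorization:
  assumes "s \<in> carrier S"
  shows "\<exists>!p. p \<in> generated_submonoid S X \<times> Units S \<and> s = fst p \<otimes> snd p"
proof -
  obtain w g where w: "w \<in> lists X" "g \<in> Units S" "s = word_prod w \<otimes> g"
    using word_unit_exists[OF assms] by blast
  show ?thesis
  proof (rule ex1I)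
    show "(word_prod w, g) \<in> generated_submonoid S X \<times> Units S
        \<and> s = fst (word_prod w, g) \<otimes> snd (word_prod w, g)"
      using w by (simp add: generated_submonoid_X)
    fix p assume "p \<in> generated_submonoid S X \<times> Units S \<and> s = fst p \<otimes> snd p"
    \<comment> \<open>Any word \<open>v\<close> with the first component of \<open>p\<close> as its
      value will do: uniqueness of words forces \<open>v = w\<close>, hence equal
      components.\<close>
    then obtain v h where "v \<in> lists X" "h \<in> Units S" "p = (word_prod v, h)" "s = word_prod v \<otimes> h"
      unfolding generated_submonoid_X by force
    then show "p = (word_prod w, g)"
      using w word_unit_unique by metis
  qed
qed

end

theorem lemma5p2:
  fixes S :: "('a, 'b) monoid_scheme"
    and l :: "'a \<Rightarrow> nat"
    and X :: "'a set"
  assumes "left_cancellative S"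
    and "generalized_1_monoid S l"
    and "l ` carrier S = UNIV"
    and "atom_transversal S X"
  shows "is_free_monoid (S\<lparr>carrier := generated_submonoid S X\<rparr>)
    \<and> (\<forall>s\<in>carrier S. \<exists>!p. p \<in> generated_submonoid S X \<times> Units S \<and> s = fst p \<otimes>\<^bsub>S\<^esub> snd p)"
proof -
  interpret monoid S
    using assms(2) by (simp add: generalized_1_monoid_def)
  interpret generalized_1_monoid_transversal S l X
    using assms by unfold_locales (simp_all add: generalized_1_monoid_def)
  show ?thesis
    using is_free_monoid_generated generated_unit_unique_factorization by blast
qed

end
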